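(* Let $(\mathfrak{L},\cdot,[\cdot,\cdot])$ be a unital transposed Poisson algebra over $\mathbb{C}$ such that $(\mathfrak{L},\cdot)$ is an integral domain, and let $\mathcal{Q}(\mathfrak{L})$ be the field of fractions of $(\mathfrak{L},\cdot)$. Then $(\mathcal{Q}(\mathfrak{L}),\bullet,\llbracket\cdot,\cdot\rrbracket)$, where $$\frac ab\bullet\frac cd=\frac{a\cdot c}{b\cdot d}\qquad\text{and}\qquad \left\llbracket\frac ab,\frac cd\right\rrbracket=\frac{[a,b]\cdot c\cdot d-a\cdot b\cdot[c,d]}{b^2\cdot d^2},$$ is a transposed Poisson field.
   Context: A transposed Poisson algebra is a triple $(\mathfrak{L},\cdot,[\cdot,\cdot])$ consisting of a vector space with two nonzero bilinear operations such that $(\mathfrak{L},\cdot)$ is a commutative associative algebra, $(\mathfrak{L},[\cdot,\cdot])$ is a Lie algebra, and $2z\cdot[x,y]=[z\cdot x,y]+[x,z\cdot y]$ for all $x,y,z\in\mathfrak{L}$. It is unital if $(\mathfrak{L},\cdot)$ has an identity element. A transposed Poisson field is a transposed Poisson algebra whose commutative associative algebra is a field. *)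

theory Defs
  imports Complex_Main "HOL-Computational_Algebra.Fraction_Field"
begin

locale bilinear_op = vector_space scale
  for scale :: "'k::field \<Rightarrow> 'a::ab_group_add \<Rightarrow> 'a" +
  fixes f :: "'a \<Rightarrow> 'a \<Rightarrow> 'a"
  assumes linear_right: "Vector_Spaces.linear scale scale (\<lambda>y. f x y)"
    and linear_left: "Vector_Spaces.linear scale scale (\<lambda>x. f x y)"

locale comm_assoc_algebra = bilinear_op scale mult
  for scale :: "'k::field \<Rightarrow> 'a::ab_group_add \<Rightarrow> 'a"
    and mult :: "'a \<Rightarrow> 'a \<Rightarrow> 'a" +
  assumes mult_comm: "mult x y = mult y x"
    and mult_assoc: "mult (mult x y) z = mult x (mult y z)"

locale lie_algebra = bilinear_op scale bracket
  for scale :: "'k::field \<Rightarrow> 'a::ab_group_add \<Rightarrow> 'a"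
    and bracket :: "'a \<Rightarrow> 'a \<Rightarrow> 'a" +
  assumes bracket_self: "bracket x x = 0"
    and jacobi: "bracket x (bracket y z) + bracket y (bracket z x) + bracket z (bracket x y) = 0"

locale transposed_poisson_algebra =
  comm_assoc_algebra scale mult + lie_algebra scale bracket
  for scale :: "'k::field \<Rightarrow> 'a::ab_group_add \<Rightarrow> 'a"
    and mult :: "'a \<Rightarrow> 'a \<Rightarrow> 'a"
    and bracket :: "'a \<Rightarrow> 'a \<Rightarrow> 'a" +
  assumes mult_nonzero: "\<exists>x y. mult x y \<noteq> 0"
    and bracket_nonzero: "\<exists>x y. bracket x y \<noteq> 0"
    and transposed_leibniz:
      "scale 2 (mult z (bracket x y)) = bracket (mult z x) y + bracket x (mult z y)"

locale transposed_poisson_field = transposed_poisson_algebra scale mult bracket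
  for scale :: "'k::field \<Rightarrow> 'a::ab_group_add \<Rightarrow> 'a"
    and mult :: "'a \<Rightarrow> 'a \<Rightarrow> 'a"
    and bracket :: "'a \<Rightarrow> 'a \<Rightarrow> 'a" +
  assumes mult_field:
    "\<exists>e. e \<noteq> 0 \<and> (\<forall>x. mult e x = x) \<and> (\<forall>x. x \<noteq> 0 \<longrightarrow> (\<exists>y. mult x y = e))"

text \<open>
  The next two operations on the field of fractions are given by formulas on representatives.
  They are meaningful only if the value does not depend on the representatives, because
  the definite description picks the unique possible value. Independence has to be
  proved from properties of \<^term>\<open>scale\<close> and \<^term>\<open>br\<close>.
\<close>

definition fract_scale :: "('k \<Rightarrow> 'a \<Rightarrow> 'a) \<Rightarrow> 'k \<Rightarrow> 'a::idom fract \<Rightarrow> 'a fract" where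
  "fract_scale scale k q = (THE r. \<exists>a b. b \<noteq> 0 \<and> q = Fract a b \<and> r = Fract (scale k a) b)"

definition fract_bracket :: "('a \<Rightarrow> 'a \<Rightarrow> 'a) \<Rightarrow> 'a::idom fract \<Rightarrow> 'a fract \<Rightarrow> 'a fract" where
  "fract_bracket br p q =
    (THE r. \<exists>a b c d. b \<noteq> 0 \<and> d \<noteq> 0 \<and> p = Fract a b \<and> q = Fract c d \<and>
       r = Fract (br a b * c * d - a * b * br c d) (b\<^sup>2 * d\<^sup>2))"

end

theory Submission
  imports Defs
begin

text \<open>
  In a unital transposed Poisson algebra the map \<open>D x = [x, 1]\<close> is a derivation and the bracket is
  \<open>[x, y] = D x \<cdot> y - x \<cdot> D y\<close>. Conversely, every derivation of a commutative algebra yields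
  a transposed Poisson bracket in this way, unless that bracket vanishes. On the field of fractions
  the quotient rule extends \<open>D\<close> to \<open>D (a/b) = (D a \<cdot> b - a \<cdot> D b) / b\<^sup>2 = [a, b] / b\<^sup>2\<close>,
  and the bracket of this extension is the displayed one.
\<close>

text \<open>Leibniz gives \<open>D (D y * z - y * D z) = D (D y) * z - y * D (D z)\<close>, since
  the terms \<open>D y * D z\<close> cancel; the cyclic sum in the Jacobi identity then vanishes. In
  the transposed Leibniz rule the two terms \<open>D z * x * y\<close> cancel, and the rest occurs
  twice, whence the factor 2.\<close>

lemma transposed_poisson_algebra_of_derivation:
  fixes scale :: "'k::field \<Rightarrow> 'a::comm_ring_1 \<Rightarrow> 'a"
  assumes alg: "bilinear_op scale (*)"
    and lin: "Vector_Spaces.linear scale scale D"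
    and leibniz: "\<And>x y. D (x * y) = D x * y + x * D y"
    and nonzero: "\<exists>x y. D x * y - x * D y \<noteq> 0"
  shows "transposed_poisson_algebra scale (*) (\<lambda>x y. D x * y - x * D y)"
proof -
  interpret bilinear_op scale "(*)" by (rule alg)
  interpret D: Vector_Spaces.linear scale scale D by (rule lin)
  have scale_left: "scale k x * y = scale k (x * y)" for k x y
    by (rule module_hom.scale[OF Vector_Spaces.linear.axioms(3)[OF linear_left]])
  have scale_right: "x * scale k y = scale k (x * y)" for k x y
    by (rule module_hom.scale[OF Vector_Spaces.linear.axioms(3)[OF linear_right]])
  have scale_2: "scale 2 x = x + x" for x
    using scale_left_distrib[of 1 1 x] by simp
  show ?thesis
  proof
    show "\<exists>x y. x * y \<noteq> (0::'a)" by (intro exI[of _ 1]) simp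
    show "\<exists>x y. D x * y - x * D y \<noteq> 0" by (rule nonzero)
  qed (simp_all add: leibniz D.add D.diff D.scale scale_left scale_right scale_right_diff_distrib
      scale_2 algebra_simps)
qed

text \<open>The class \<open>idom\<close> supplies the unit, and characteristic 0 allows the scalar
  2 to be cancelled in \<open>br_one_mult\<close>.\<close>

locale domain_transposed_poisson = transposed_poisson_algebra scale "(*)" br
  for scale :: "'k::field_char_0 \<Rightarrow> 'a::idom \<Rightarrow> 'a" and br :: "'a \<Rightarrow> 'a \<Rightarrow> 'a"
begin

lemma scale_mult_left: "scale k x * y = scale k (x * y)"
  by (rule module_hom.scale[OF Vector_Spaces.linear.axioms(3)[OF comm_assoc_algebra.axioms(1)[THEN bilinear_op.linear_left]]])
    unfold_locales

lemma br_add_left: "br (x + y) z = br x z + br y z"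
  by (rule module_hom.add[OF Vector_Spaces.linear.axioms(3)[OF lie_algebra.axioms(1)[THEN bilinear_op.linear_left]]])
    unfold_locales

lemma br_add_right: "br z (x + y) = br z x + br z y"
  by (rule module_hom.add[OF Vector_Spaces.linear.axioms(3)[OF lie_algebra.axioms(1)[THEN bilinear_op.linear_right]]])
    unfold_locales

lemma br_scale_left: "br (scale k x) y = scale k (br x y)"
  by (rule module_hom.scale[OF Vector_Spaces.linear.axioms(3)[OF lie_algebra.axioms(1)[THEN bilinear_op.linear_left]]])
    unfold_locales

lemma br_swap: "br x y = - br y x"
  using bracket_self[of "x + y"] bracket_self[of x] bracket_self[of y]
  by (simp add: br_add_left br_add_right eq_neg_iff_add_eq_0 add.commute)

text \<open>The transposed Leibniz rule with 1 in the second slot of the bracket gives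
  \<open>two\<close>. Adding \<open>two\<close> to its copy with \<open>x\<close> and
  \<open>y\<close> exchanged kills the antisymmetric part \<open>br x y + br y x\<close> and leaves
  twice the derivation rule. Putting that rule back into \<open>two\<close> isolates
  \<open>br x y\<close>.\<close>

lemma br_one_mult: "br (x * y) 1 = br x 1 * y + x * br y 1"
  and br_eq_br_one: "br x y = br x 1 * y - x * br y 1"
proof -
  have two: "scale 2 (y * br x 1) = br (x * y) 1 + br x y" for x y
    using transposed_leibniz[of y x 1] by (simp add: mult.commute)
  have "scale 2 (br x 1 * y + x * br y 1) = br (x * y) 1 + br (x * y) 1 + (br x y + br y x)"
    using two[of y x] two[of x y] by (simp add: scale_right_distrib algebra_simps)
  also have "\<dots> = scale 2 (br (x * y) 1)"
    using br_swap[of x y] scale_left_distrib[of 1 1 "br (x * y) 1"] by simp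
  finally show leibniz: "br (x * y) 1 = br x 1 * y + x * br y 1"
    by simp
  have "br x y = (y * br x 1 + y * br x 1) - br (x * y) 1"
    using two[of y x] scale_left_distrib[of 1 1 "y * br x 1"] by (simp add: algebra_simps)
  then show "br x y = br x 1 * y - x * br y 1"
    using leibniz by (simp add: algebra_simps)
qed

lemma fract_scale_Fract:
  assumes "b \<noteq> 0"
  shows "fract_scale scale k (Fract a b) = Fract (scale k a) b"
  unfolding fract_scale_def
proof (rule the_equality)
  show "\<exists>a' b'. b' \<noteq> 0 \<and> Fract a b = Fract a' b' \<and> Fract (scale k a) b = Fract (scale k a') b'"
    using assms by blast
next
  fix r
  assume "\<exists>a' b'. b' \<noteq> 0 \<and> Fract a b = Fract a' b' \<and> r = Fract (scale k a') b'"
  then obtain a' b' where "b' \<noteq> 0" "Fract a b = Fract a' b'" "r = Fract (scale k a') b'"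
    by blast
  then show "r = Fract (scale k a) b"
    using assms by (simp add: eq_fract scale_mult_left)
qed

text \<open>This is the well-definedness of the derivation \<open>br x 1\<close> extended to
  fractions by the quotient rule; it comes from differentiating the equation
  \<open>a * b' = a' * b\<close>.\<close>

lemma fract_quotient_rule_cong:
  assumes "b \<noteq> 0" "b' \<noteq> 0" "Fract a b = Fract a' b'"
  shows "Fract (br a b) (b\<^sup>2) = Fract (br a' b') (b'\<^sup>2)"
proof -
  have eq: "a * b' = a' * b"
    using assms by (simp add: eq_fract)
  then have "br a 1 * b' + a * br b' 1 = br a' 1 * b + a' * br b 1"
    by (metis br_one_mult)
  \<comment> \<open>Multiply the differentiated equation by \<open>b * b'\<close>, then use
    \<open>eq\<close> to rewrite the terms that contain \<open>br b 1\<close> and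
    \<open>br b' 1\<close>.\<close>
  with eq have "(br a 1 * b - a * br b 1) * b'\<^sup>2 = (br a' 1 * b' - a' * br b' 1) * b\<^sup>2"
    by algebra
  then show ?thesis
    using assms by (simp add: eq_fract br_eq_br_one[of a b] br_eq_br_one[of a' b'])
qed

text \<open>Each factor on the right involves only one of the two fractions, so independence of
  representatives reduces to \<open>fract_quotient_rule_cong\<close>, applied to each fraction
  separately.\<close>

lemma fract_bracket_Fract_split:
  assumes "b \<noteq> 0" "d \<noteq> 0"
  shows "Fract (br a b * c * d - a * b * br c d) (b\<^sup>2 * d\<^sup>2) =
    Fract (br a b) (b\<^sup>2) * Fract c d - Fract a b * Fract (br c d) (d\<^sup>2)"
  using assms by (simp add: eq_fract power2_eq_square algebra_simps)

lemma fract_bracket_Fract: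
  assumes "b \<noteq> 0" "d \<noteq> 0"
  shows "fract_bracket br (Fract a b) (Fract c d) =
    Fract (br a b * c * d - a * b * br c d) (b\<^sup>2 * d\<^sup>2)"
  unfolding fract_bracket_def
proof (rule the_equality)
  show "\<exists>a' b' c' d'. b' \<noteq> 0 \<and> d' \<noteq> 0 \<and> Fract a b = Fract a' b' \<and> Fract c d = Fract c' d' \<and>
      Fract (br a b * c * d - a * b * br c d) (b\<^sup>2 * d\<^sup>2) =
      Fract (br a' b' * c' * d' - a' * b' * br c' d') (b'\<^sup>2 * d'\<^sup>2)"
    using assms by blast
next
  fix r
  assume "\<exists>a' b' c' d'. b' \<noteq> 0 \<and> d' \<noteq> 0 \<and> Fract a b = Fract a' b' \<and> Fract c d = Fract c' d' \<and>
      r = Fract (br a' b' * c' * d' - a' * b' * br c' d') (b'\<^sup>2 * d'\<^sup>2)"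
  then obtain a' b' c' d' where "b' \<noteq> 0" "d' \<noteq> 0" "Fract a b = Fract a' b'" "Fract c d = Fract c' d'"
      "r = Fract (br a' b' * c' * d' - a' * b' * br c' d') (b'\<^sup>2 * d'\<^sup>2)"
    by blast
  then show "r = Fract (br a b * c * d - a * b * br c d) (b\<^sup>2 * d\<^sup>2)"
    using assms fract_quotient_rule_cong[of b b' a a'] fract_quotient_rule_cong[of d d' c c']
    by (simp only: fract_bracket_Fract_split not_False_eq_True)
qed

text \<open>Writing 1 as 1/1, the second term of the numerator contains \<open>br 1 1 = 0\<close>.
  Thus bracketing with 1 is exactly the extended derivation.\<close>

lemma fract_bracket_one:
  assumes "b \<noteq> 0"
  shows "fract_bracket br (Fract a b) 1 = Fract (br a b) (b\<^sup>2)"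
  using assms by (simp add: One_fract_def fract_bracket_Fract bracket_self)

lemma fract_bracket_eq_bracket_one:
  "fract_bracket br p q = fract_bracket br p 1 * q - p * fract_bracket br q 1"
  by (cases p, cases q)
    (simp only: fract_bracket_Fract fract_bracket_one fract_bracket_Fract_split not_False_eq_True)

lemma vector_space_fract_scale: "vector_space (fract_scale scale)"
proof
  fix k l and p q :: "'a fract"
  obtain a b where p: "p = Fract a b" "b \<noteq> 0" by (cases p)
  obtain c d where q: "q = Fract c d" "d \<noteq> 0" by (cases q)
  show "fract_scale scale k (p + q) = fract_scale scale k p + fract_scale scale k q"
    using p q by (simp add: fract_scale_Fract scale_right_distrib scale_mult_left)
  show "fract_scale scale (k + l) p = fract_scale scale k p + fract_scale scale l p"
    using p by (simp add: fract_scale_Fract scale_left_distrib eq_fract algebra_simps)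
  show "fract_scale scale k (fract_scale scale l p) = fract_scale scale (k * l) p"
    using p by (simp add: fract_scale_Fract)
  show "fract_scale scale 1 p = p"
    using p by (simp add: fract_scale_Fract)
qed

lemma fract_scale_mult_left: "fract_scale scale k p * q = fract_scale scale k (p * q)"
  by (cases p, cases q) (simp add: fract_scale_Fract scale_mult_left)

lemma fract_scale_mult_right: "p * fract_scale scale k q = fract_scale scale k (p * q)"
  using fract_scale_mult_left[of k q p] by (simp add: mult.commute)

lemma bilinear_op_fract_mult: "bilinear_op (fract_scale scale) (*)"
proof -
  interpret F: vector_space "fract_scale scale" by (rule vector_space_fract_scale)
  show ?thesis
    by unfold_locales (simp_all add: fract_scale_mult_left fract_scale_mult_right algebra_simps)
qed

lemma linear_fract_bracket_one:
  "Vector_Spaces.linear (fract_scale scale) (fract_scale scale) (\<lambda>p. fract_bracket br p 1)"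
proof -
  interpret F: vector_space "fract_scale scale" by (rule vector_space_fract_scale)
  show ?thesis
  proof
    fix k and p q :: "'a fract"
    obtain a b where p: "p = Fract a b" "b \<noteq> 0" by (cases p)
    obtain c d where q: "q = Fract c d" "d \<noteq> 0" by (cases q)
    \<comment> \<open>The quotient rule for the sum has denominator \<open>(b * d)^2\<close>, which
      is also the common denominator of the two summands, so additivity is this identity of
      numerators.\<close>
    have "br (a * d + c * b) (b * d) = br a b * d\<^sup>2 + br c d * b\<^sup>2"
      unfolding br_eq_br_one[of _ "b * d"] br_eq_br_one[of a b] br_eq_br_one[of c d]
      by (simp add: br_one_mult br_add_left power2_eq_square algebra_simps)
    then show "fract_bracket br (p + q) 1 = fract_bracket br p 1 + fract_bracket br q 1"
      using p q by (simp add: fract_bracket_one power_mult_distrib)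
    show "fract_bracket br (fract_scale scale k p) 1 = fract_scale scale k (fract_bracket br p 1)"
      using p by (simp add: fract_bracket_one fract_scale_Fract br_scale_left)
  qed
qed

lemma fract_bracket_one_mult:
  "fract_bracket br (p * q) 1 = fract_bracket br p 1 * q + p * fract_bracket br q 1"
proof -
  obtain a b where p: "p = Fract a b" "b \<noteq> 0" by (cases p)
  obtain c d where q: "q = Fract c d" "d \<noteq> 0" by (cases q)
  \<comment> \<open>The four terms produced by the derivation rule are regrouped according to the
    pairs \<open>a\<close>, \<open>b\<close> and \<open>c\<close>, \<open>d\<close>.\<close>
  have "br (a * c) (b * d) = br a b * c * d + a * b * br c d"
    unfolding br_eq_br_one[of _ "b * d"] br_eq_br_one[of a b] br_eq_br_one[of c d]
    by (simp add: br_one_mult algebra_simps)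
  then show ?thesis
    using p q by (simp add: fract_bracket_one eq_fract power2_eq_square algebra_simps)
qed

lemma transposed_poisson_field_fract:
  "transposed_poisson_field (fract_scale scale) (*) (fract_bracket br)"
proof -
  obtain x y where "br x y \<noteq> 0"
    using bracket_nonzero by blast
  \<comment> \<open>On fractions with denominator 1 the numerator is
    \<open>br x 1 * y - x * br y 1\<close>, that is \<open>br x y\<close>: the new bracket extends
    the old one and inherits its nonvanishing.\<close>
  then have "fract_bracket br (Fract x 1) (Fract y 1) \<noteq> 0"
    by (simp add: fract_bracket_Fract Zero_fract_def eq_fract flip: br_eq_br_one)
  then have nonzero: "\<exists>p q. fract_bracket br p 1 * q - p * fract_bracket br q 1 \<noteq> 0"
    by (metis fract_bracket_eq_bracket_one)
  have br_eq: "fract_bracket br = (\<lambda>p q. fract_bracket br p 1 * q - p * fract_bracket br q 1)"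
    by (intro ext) (rule fract_bracket_eq_bracket_one)
  have "transposed_poisson_algebra (fract_scale scale) (*) (fract_bracket br)"
    by (subst br_eq) (rule transposed_poisson_algebra_of_derivation
        [OF bilinear_op_fract_mult linear_fract_bracket_one fract_bracket_one_mult nonzero])
  moreover have "\<exists>e :: 'a fract. e \<noteq> 0 \<and> (\<forall>x. e * x = x) \<and> (\<forall>x. x \<noteq> 0 \<longrightarrow> (\<exists>y. x * y = e))"
    by (intro exI[of _ 1]) (auto intro: right_inverse)
  ultimately show ?thesis
    by (simp add: transposed_poisson_field_def transposed_poisson_field_axioms_def)
qed

end

theorem theorem32:
  fixes scale :: "complex \<Rightarrow> 'a::idom \<Rightarrow> 'a"
    and br :: "'a \<Rightarrow> 'a \<Rightarrow> 'a"
  assumes "transposed_poisson_algebra scale (*) br"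
  shows "(\<forall>k a b. b \<noteq> 0 \<longrightarrow> fract_scale scale k (Fract a b) = Fract (scale k a) b) \<and>
    (\<forall>(a :: 'a) b c d. b \<noteq> 0 \<longrightarrow> d \<noteq> 0 \<longrightarrow> Fract a b * Fract c d = Fract (a * c) (b * d)) \<and>
    (\<forall>a b c d. b \<noteq> 0 \<longrightarrow> d \<noteq> 0 \<longrightarrow>
       fract_bracket br (Fract a b) (Fract c d) =
         Fract (br a b * c * d - a * b * br c d) (b\<^sup>2 * d\<^sup>2)) \<and>
    transposed_poisson_field (fract_scale scale) (*) (fract_bracket br)"
proof -
  interpret domain_transposed_poisson scale br
    using assms by (rule domain_transposed_poisson.intro)
  show ?thesis
    using fract_scale_Fract fract_bracket_Fract transposed_poisson_field_fract by simp
qed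

end
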